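(* Let $\sigma>0$ and let $V\in C^\infty([1,\infty))$ satisfy $V(x)=W(1/x)$ with $W\in G^{2,\sigma}([0,1])$. Then for any $\rho<\sigma$ and $\epsilon>0$ one can write $$V(x)=V_1(x)+V_2(x),\qquad x\in[1,\infty),$$ where: (i) $V_1\in C^\infty([1,\infty))$ and there exists $C$ such that $|V_1(x)|\le Ce^{-\rho x}$ for all $x\in[1,\infty)$; (ii) $V_2(z)$ is holomorphic in $\mathcal C_\epsilon:=\{z\in\mathbb C : |\arg z|<\pi/2-\epsilon\}$ and $$V_2(z)\sim\sum_{\ell=0}^\infty\frac{W^{(\ell)}(0)}{\ell!}z^{-\ell},\qquad z\to\infty,\ z\in\mathcal C_\epsilon.$$
   Context: Notation: $D_x:=-i\partial_x$. For $\sigma>0$, $$G^{2,\sigma}([0,1]):=\{u\in C^\infty([0,1]) : \exists\, C\ \ \forall n\in\mathbb N,\ \sup_{x\in[0,1]}|D_x^nu(x)|\le C\sigma^{-n}(n!)^2\}.$$ Functions may be complex valued. The symbol $\sim$ denotes an asymptotic expansion: for every $N$, $V_2(z)-\sum_{\ell=0}^{N-1}\frac{W^{(\ell)}(0)}{\ell!}z^{-\ell}=O(|z|^{-N})$ as $z\to\infty$ in $\mathcal C_\epsilon$. *)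

theory Defs
  imports "HOL-Complex_Analysis.Complex_Analysis" "HOL-Library.Landau_Symbols"
begin

text \<open>
  Derivative along a real set \<open>S\<close>. At an endpoint of a closed interval this is the one-sided
  derivative, and its values on \<open>S\<close> depend only on the restriction of \<open>f\<close> to \<open>S\<close>.
  The iterated derivative of order \<open>n\<close> is \<open>(deriv_on S ^^ n) f\<close>.
\<close>

definition deriv_on :: "real set \<Rightarrow> (real \<Rightarrow> complex) \<Rightarrow> real \<Rightarrow> complex" where
  "deriv_on S f = (\<lambda>x. vector_derivative f (at x within S))"

text \<open>Intended for nondegenerate intervals \<open>S\<close>, where the derivative within \<open>S\<close> is unique.\<close>

definition smooth_on :: "real set \<Rightarrow> (real \<Rightarrow> complex) \<Rightarrow> bool" where
  "smooth_on S f \<longleftrightarrow> (\<forall>n. (deriv_on S ^^ n) f differentiable_on S)"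

definition D_on :: "real set \<Rightarrow> (real \<Rightarrow> complex) \<Rightarrow> real \<Rightarrow> complex" where
  "D_on S f = (\<lambda>x. - \<i> * deriv_on S f x)"

definition gevrey2 :: "real \<Rightarrow> (real \<Rightarrow> complex) set" where
  "gevrey2 \<sigma> = {u. smooth_on {0..1} u \<and>
     (\<exists>C. \<forall>n. \<forall>x\<in>{0..1}. norm ((D_on {0..1} ^^ n) u x) \<le> C * (1 / \<sigma> ^ n) * (fact n)\<^sup>2)}"

text \<open>The origin is removed explicitly because \<open>Arg 0 = 0\<close> by convention.\<close>

definition sector :: "real \<Rightarrow> complex set" where
  "sector \<epsilon> = {z. z \<noteq> 0 \<and> \<bar>Arg z\<bar> < pi / 2 - \<epsilon>}"

text \<open>\<open>f z \<sim> (\<Sum>l. a l * z\<^sup>-\<^sup>l)\<close> as \<open>z\<close> tends to infinity within \<open>S\<close>; the series need not converge.\<close>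

definition asymptotic_series :: "complex set \<Rightarrow> (complex \<Rightarrow> complex) \<Rightarrow> (nat \<Rightarrow> complex) \<Rightarrow> bool" where
  "asymptotic_series S f a \<longleftrightarrow>
     (\<forall>N. (\<lambda>z. f z - (\<Sum>l<N. a l / z ^ l))
        \<in> O[inf at_infinity (principal S)](\<lambda>z. complex_of_real (1 / norm z ^ N)))"

end

theory Submission
  imports Defs
begin

text \<open>
  Put \<open>a l = W\<^sup>(\<^sup>l\<^sup>)(0) / l!\<close>. The Gevrey bound gives \<open>\<bar>a l\<bar> \<le> C l! \<sigma>\<^sup>-\<^sup>l\<close>, so the Borel transform
  \<open>\<Sum>l. a (l + 1) s\<^sup>l / l!\<close> converges for \<open>\<bar>s\<bar> < \<sigma>\<close>. For \<open>0 < r < \<sigma>\<close> with \<open>\<rho> \<le> r\<close>, the function \<open>V2\<close> is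
  \<open>a 0\<close> plus the Laplace integral of this transform over \<open>[0, r]\<close>. Integrated term by term it reads
  \<open>V2 z = \<Sum>l. a l z\<^sup>-\<^sup>l P l (r z)\<close> with the regularized incomplete gamma function
  \<open>P l w = 1 - e\<^sup>-\<^sup>w \<Sum>k<l. w\<^sup>k / k!\<close>.

  Since \<open>\<bar>P l (r z)\<bar> \<le> \<bar>r z\<bar>\<^sup>l / l!\<close> for \<open>Re z \<ge> 0\<close>, the series is dominated by \<open>C \<Sum>l. (r / \<sigma>)\<^sup>l\<close> on the right
  half-plane and \<open>V2\<close> is holomorphic there (\<open>holomorphic_borel_sum\<close>). The asymptotic expansion is
  Watson's lemma (\<open>asymptotic_series_borel_sum\<close>): the tail from \<open>l = N\<close> on is \<open>O((Re z)\<^sup>-\<^sup>N)\<close>, and in the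
  first \<open>N\<close> terms \<open>1 - P l (r z)\<close> is exponentially small in a sector.

  On the real axis, summation by parts together with \<open>P k - P (k + 1) = e\<^sup>-\<^sup>w w\<^sup>k / k!\<close> yields
  \<open>V x - V2 x = e\<^sup>-\<^sup>r\<^sup>x \<Sum>k. (r x)\<^sup>k / k! (W (1/x) - T (k + 1))\<close>, where \<open>T k\<close> is the sum of the first \<open>k\<close>
  terms of the Taylor series of \<open>W\<close> at \<open>0\<close>, evaluated at \<open>1/x\<close>. By Taylor's formula and the Gevrey
  bound the \<open>k\<close>-th error is at most \<open>C (k + 1)! / (\<sigma> x)\<^sup>k\<^sup>+\<^sup>1\<close>, so the series is bounded by
  \<open>C / (\<sigma> x) \<Sum>k. (k + 1) (r / \<sigma>)\<^sup>k\<close> and \<open>V1 = V - V2\<close> is \<open>O(e\<^sup>-\<^sup>r\<^sup>x)\<close> on \<open>[1, \<infinity>)\<close>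
  (\<open>norm_minus_borel_sum_le\<close>).
\<close>

section \<open>Comparison of derivatives, Taylor's formula and the exponential series\<close>

lemma norm_diff_le_of_vector_derivative_le:
  fixes f :: "real \<Rightarrow> 'a::real_normed_vector"
  assumes "0 \<le> b"
    and f: "\<And>s. s \<in> {0..b} \<Longrightarrow> (f has_vector_derivative f' s) (at s within {0..b})"
    and \<phi>: "\<And>s. s \<in> {0..b} \<Longrightarrow> (\<phi> has_real_derivative \<phi>' s) (at s within {0..b})"
    and le: "\<And>s. s \<in> {0..b} \<Longrightarrow> norm (f' s) \<le> \<phi>' s"
  shows "norm (f b - f 0) \<le> \<phi> b - \<phi> 0"
proof (cases "b = 0")
  case False
  show ?thesis
  proof (rule differentiable_bound_general)
    show "0 < b" using assms(1) False by simp
    show "continuous_on {0..b} f" "continuous_on {0..b} \<phi>"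
      unfolding continuous_on_eq_continuous_within
      using has_vector_derivative_continuous[OF f] DERIV_continuous[OF \<phi>] by blast+
    fix s assume s: "0 < s" "s < b"
    have at: "at s within {0..b} = at s"
      using s by (simp add: at_within_Icc_at)
    show "(f has_vector_derivative f' s) (at s)" using f[of s] s at by simp
    show "(\<phi> has_vector_derivative \<phi>' s) (at s)"
      using \<phi>[of s] s at by (simp add: has_real_derivative_iff_has_vector_derivative)
    show "norm (f' s) \<le> \<phi>' s" using le s by simp
  qed
qed simp

lemma DERIV_power_over_fact:
  fixes w :: "'a::real_normed_field"
  shows "((\<lambda>w. w ^ Suc l / fact (Suc l)) has_field_derivative w ^ l / fact l) (at w within S)"
proof -
  have eq: "(1 + of_nat l) * w ^ l / fact (Suc l) = w ^ l / fact l"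
    by (simp add: fact_reduce del: of_nat_Suc)
       (metis mult_divide_mult_cancel_left of_nat_Suc of_nat_neq_0)
  show ?thesis
    unfolding eq[symmetric] by (auto intro!: derivative_eq_intros simp del: fact_Suc power_Suc)
qed

lemma taylor_remainder_bound:
  fixes D :: "nat \<Rightarrow> real \<Rightarrow> 'a::real_normed_vector"
  assumes D: "\<And>n s. s \<in> {0..b} \<Longrightarrow> (D n has_vector_derivative D (Suc n) s) (at s within {0..b})"
    and M: "\<And>s. s \<in> {0..b} \<Longrightarrow> norm (D p s) \<le> M"
    and t: "t \<in> {0..b}"
  shows "norm (D 0 t - (\<Sum>i<p. (t ^ i / fact i) *\<^sub>R D i 0)) \<le> M * t ^ p / fact p"
  using D M t
proof (induction p arbitrary: D t)
  case (Suc p)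
  define R where "R = (\<lambda>s. D 0 s - (\<Sum>i<Suc p. (s ^ i / fact i) *\<^sub>R D i 0))"
  define R' where "R' = (\<lambda>s. D 1 s - (\<Sum>i<p. (s ^ i / fact i) *\<^sub>R D (Suc i) 0))"
  have R: "(R has_vector_derivative R' s) (at s within {0..t})" if "s \<in> {0..t}" for s
  proof -
    have pow: "((\<lambda>s. (s ^ Suc i / fact (Suc i)) *\<^sub>R D (Suc i) 0) has_vector_derivative
        (s ^ i / fact i) *\<^sub>R D (Suc i) 0) (at s within {0..t})" for i
      using has_vector_derivative_scaleR[OF DERIV_power_over_fact has_vector_derivative_const]
      by simp
    have D0: "(D 0 has_vector_derivative D 1 s) (at s within {0..t})"
      using Suc.prems(1)[of s 0] that Suc.prems(3)
      by (auto intro: has_vector_derivative_within_subset)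
    show ?thesis
      unfolding R_def R'_def sum.lessThan_Suc_shift
      by (rule derivative_eq_intros pow D0 refl | simp)+
  qed
  have R'_le: "norm (R' s) \<le> M * s ^ p / fact p" if "s \<in> {0..t}" for s
    using Suc.IH[of "\<lambda>n. D (Suc n)" s] Suc.prems that by (simp add: R'_def)
  have "norm (R t - R 0) \<le> M * t ^ Suc p / fact (Suc p) - M * 0 ^ Suc p / fact (Suc p)"
  proof (rule norm_diff_le_of_vector_derivative_le[OF _ R _ R'_le])
    fix s assume "s \<in> {0..t}"
    show "((\<lambda>s. M * s ^ Suc p / fact (Suc p)) has_real_derivative M * s ^ p / fact p)
        (at s within {0..t})"
      using DERIV_cmult[OF DERIV_power_over_fact, of M p s] by simp
  qed (use Suc.prems in auto)
  moreover have "R 0 = 0"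
    by (simp add: R_def sum.lessThan_Suc_shift del: sum.lessThan_Suc)
  ultimately show ?case by (simp add: R_def)
qed simp

lemma exp_partial_sum_le:
  fixes y :: real
  assumes "0 \<le> y"
  shows "(\<Sum>k<n. y ^ k / fact k) \<le> exp y"
  using sum_le_suminf[OF summable_exp_generic[of y], of "{..<n}"] assms
  by (simp add: exp_def divide_inverse mult.commute)

lemma exp_minus_le_inverse_power:
  fixes y :: real
  assumes "0 < y"
  shows "exp (- y) \<le> fact n / y ^ n"
proof -
  have "y ^ n / fact n \<le> (\<Sum>k<Suc n. y ^ k / fact k)"
    using assms by (simp add: sum_nonneg)
  also have "\<dots> \<le> exp y" using assms by (intro exp_partial_sum_le) simp
  finally show ?thesis using assms by (simp add: exp_minus field_simps)
qed

section \<open>The regularized incomplete gamma function at integer order\<close>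

text \<open>
  The regularized lower incomplete gamma function of integer order \<open>l\<close>; for \<open>l > 0\<close> it equals
  \<open>\<integral>\<^sub>0\<^sup>w e\<^sup>-\<^sup>u u\<^sup>l\<^sup>-\<^sup>1 du / (l - 1)!\<close>. The closed form makes it entire in \<open>w\<close> and avoids integrals.
\<close>

definition gamma_P :: "nat \<Rightarrow> 'a \<Rightarrow> 'a::{real_normed_field,banach}" where
  "gamma_P l w = 1 - exp (- w) * (\<Sum>k<l. w ^ k / fact k)"

lemma gamma_P_0 [simp]: "gamma_P 0 w = 1"
  by (simp add: gamma_P_def)

lemma gamma_P_Suc_at_0 [simp]: "gamma_P (Suc l) 0 = 0"
  by (simp add: gamma_P_def sum.lessThan_Suc_shift del: sum.lessThan_Suc)

lemma gamma_P_Suc: "gamma_P (Suc l) w = gamma_P l w - exp (- w) * (w ^ l / fact l)"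
  by (simp add: gamma_P_def algebra_simps)

lemma gamma_P_le_1: "0 \<le> w \<Longrightarrow> gamma_P l w \<le> 1" for w :: real
  by (simp add: gamma_P_def sum_nonneg)

lemma has_field_derivative_gamma_P:
  "(gamma_P (Suc l) has_field_derivative exp (- w) * (w ^ l / fact l)) (at w within S)"
proof (induction l)
  case 0
  show ?case unfolding gamma_P_def by (auto intro!: derivative_eq_intros)
next
  case (Suc l)
  have "((\<lambda>w. gamma_P (Suc l) w - exp (- w) * (w ^ Suc l / fact (Suc l))) has_field_derivative
      exp (- w) * (w ^ Suc l / fact (Suc l))) (at w within S)"
    by (rule derivative_eq_intros Suc.IH DERIV_power_over_fact refl | simp)+
  then show ?case unfolding gamma_P_Suc[of "Suc l", symmetric] .
qed

lemma has_vector_derivative_gamma_P_ray: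
  fixes z :: complex
  shows "((\<lambda>s. gamma_P (Suc l) (of_real s * z)) has_vector_derivative
    z * (exp (- (of_real s * z)) * ((of_real s * z) ^ l / fact l))) (at s within S)"
proof -
  have "((\<lambda>w. gamma_P (Suc l) (w * z)) has_field_derivative
      exp (- (of_real s * z)) * ((of_real s * z) ^ l / fact l) * z) (at (of_real s))"
    by (rule DERIV_chain2[OF has_field_derivative_gamma_P]) (auto intro!: derivative_eq_intros)
  from has_vector_derivative_real_field[OF this] show ?thesis by (simp add: mult.commute)
qed

lemma norm_gamma_P_le_power:
  fixes z :: complex
  assumes "0 \<le> Re z" "0 \<le> r"
  shows "norm (gamma_P l (of_real r * z)) \<le> norm z ^ l * r ^ l / fact l"
proof (cases l)
  case (Suc m)
  let ?f = "\<lambda>s. gamma_P (Suc m) (complex_of_real s * z)"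
  have "norm (?f r - ?f 0) \<le> norm z ^ Suc m * r ^ Suc m / fact (Suc m)
      - norm z ^ Suc m * 0 ^ Suc m / fact (Suc m)"
  proof (rule norm_diff_le_of_vector_derivative_le[OF assms(2) has_vector_derivative_gamma_P_ray])
    fix s assume s: "s \<in> {0..r}"
    show "((\<lambda>s. norm z ^ Suc m * s ^ Suc m / fact (Suc m)) has_real_derivative
        norm z ^ Suc m * s ^ m / fact m) (at s within {0..r})"
      using DERIV_cmult[OF DERIV_power_over_fact, of "norm z ^ Suc m" m s] by simp
    have "exp (- (s * Re z)) \<le> 1" using s assms by simp
    then have "norm z * (exp (- (s * Re z)) * ((s * norm z) ^ m / fact m))
        \<le> norm z * (1 * ((s * norm z) ^ m / fact m))"
      using s by (intro mult_left_mono mult_right_mono) auto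
    then show "norm (z * (exp (- (of_real s * z)) * ((of_real s * z) ^ m / fact m)))
        \<le> norm z ^ Suc m * s ^ m / fact m"
      using s by (simp add: norm_mult norm_divide norm_power norm_exp_eq_Re power_mult_distrib mult_ac)
  qed
  then show ?thesis using Suc by (simp add: mult_ac)
qed simp

text \<open>
  In the integral representation, all but \<open>n\<close> of the factors \<open>s\<close> of \<open>s\<^sup>m\<close> are bounded by \<open>r\<close>; the
  remaining integral of \<open>s\<^sup>n e\<^sup>-\<^sup>s\<^sup>x\<close> supplies the decay in \<open>x = Re z\<close>.
\<close>

lemma norm_gamma_P_le_decay:
  fixes z :: complex
  assumes z: "0 < Re z" and r: "0 \<le> r" and nm: "n \<le> m"
  shows "norm (gamma_P (Suc m) (of_real r * z))
    \<le> norm z ^ Suc m * (r ^ (m - n) * fact n / (fact m * Re z ^ Suc n))"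
proof -
  let ?f = "\<lambda>s. gamma_P (Suc m) (complex_of_real s * z)"
  define x where "x = Re z"
  define K where "K = norm z ^ Suc m * (r ^ (m - n) * fact n / (fact m * x ^ Suc n))"
  have x: "x > 0" and K: "K \<ge> 0" using z r by (auto simp: x_def K_def)
  have "norm (?f r - ?f 0) \<le> K * gamma_P (Suc n) (r * x) - K * gamma_P (Suc n) (0 * x)"
  proof (rule norm_diff_le_of_vector_derivative_le[OF r has_vector_derivative_gamma_P_ray])
    fix s assume s: "s \<in> {0..r}"
    show "((\<lambda>s. K * gamma_P (Suc n) (s * x)) has_real_derivative
        K * (exp (- (s * x)) * ((s * x) ^ n / fact n) * x)) (at s within {0..r})"
      by (intro DERIV_cmult DERIV_chain2[OF has_field_derivative_gamma_P])
         (auto intro!: derivative_eq_intros)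
    have "s ^ m = s ^ (m - n) * s ^ n" using nm by (simp flip: power_add)
    also have "\<dots> \<le> r ^ (m - n) * s ^ n" using s by (intro mult_right_mono power_mono) auto
    finally have "norm z ^ Suc m * exp (- (s * x)) / fact m * s ^ m
        \<le> norm z ^ Suc m * exp (- (s * x)) / fact m * (r ^ (m - n) * s ^ n)"
      by (intro mult_left_mono) auto
    also have "\<dots> = K * (exp (- (s * x)) * ((s * x) ^ n / fact n) * x)"
      using x by (simp add: K_def power_mult_distrib divide_simps)
    finally show "norm (z * (exp (- (of_real s * z)) * ((of_real s * z) ^ m / fact m)))
        \<le> K * (exp (- (s * x)) * ((s * x) ^ n / fact n) * x)"
      using s by (simp add: norm_mult norm_divide norm_power norm_exp_eq_Re power_mult_distrib
          mult_ac x_def)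
  qed
  also have "\<dots> \<le> K * 1"
    using K x r by (simp add: mult_left_le gamma_P_le_1)
  finally show ?thesis by (simp add: K_def x_def)
qed

section \<open>The truncated Borel sum of a series with factorially bounded coefficients\<close>

text \<open>
  The Borel sum of \<open>\<Sum>l. a l * z\<^sup>-\<^sup>l\<close> with the Laplace integral cut off at \<open>r\<close>, that is,
  \<open>a 0 + \<integral>\<^sub>0\<^sup>r e\<^sup>-\<^sup>z\<^sup>s (\<Sum>l. a (l + 1) s\<^sup>l / l!) ds\<close>, integrated term by term.
\<close>

definition borel_sum :: "real \<Rightarrow> (nat \<Rightarrow> complex) \<Rightarrow> complex \<Rightarrow> complex" where
  "borel_sum r a z = (\<Sum>l. a l * (gamma_P l (of_real r * z) / z ^ l))"

context
  fixes a :: "nat \<Rightarrow> complex" and C \<sigma> r :: real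
  assumes a: "\<And>l. norm (a l) \<le> C * fact l / \<sigma> ^ l"
    and r: "0 < r" "r < \<sigma>"
begin

lemma C_nonneg: "0 \<le> C"
  using order_trans[OF norm_ge_zero a[of 0]] by simp

lemma norm_borel_term_le:
  assumes "0 < Re z"
  shows "norm (a l * (gamma_P l (of_real r * z) / z ^ l)) \<le> C * (r / \<sigma>) ^ l"
proof -
  have z: "norm z > 0" using assms by auto
  have "norm (a l * (gamma_P l (of_real r * z) / z ^ l))
      = norm (a l) * (norm (gamma_P l (of_real r * z)) / norm z ^ l)"
    by (simp add: norm_mult norm_divide norm_power)
  also have "\<dots> \<le> (C * fact l / \<sigma> ^ l) * ((norm z ^ l * r ^ l / fact l) / norm z ^ l)"
    using assms r C_nonneg a by (intro mult_mono divide_right_mono norm_gamma_P_le_power) auto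
  also have "\<dots> = C * (r / \<sigma>) ^ l" using z by (simp add: power_divide)
  finally show ?thesis .
qed

lemma summable_majorant: "summable (\<lambda>l. C * (r / \<sigma>) ^ l)"
  using r by (intro summable_mult summable_geometric) simp

lemma summable_borel_term:
  "0 < Re z \<Longrightarrow> summable (\<lambda>l. a l * (gamma_P l (of_real r * z) / z ^ l))"
  by (rule summable_comparison_test'[OF summable_majorant norm_borel_term_le])

lemma holomorphic_borel_sum: "borel_sum r a holomorphic_on {z. 0 < Re z}"
proof (rule holomorphic_uniform_sequence[OF open_halfspace_Re_gt])
  show "(\<lambda>z. \<Sum>l<n. a l * (gamma_P l (of_real r * z) / z ^ l)) holomorphic_on {z. 0 < Re z}" for n
    unfolding gamma_P_def by (auto intro!: holomorphic_intros)
  fix x :: complex assume "x \<in> {z. 0 < Re z}"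
  then obtain d where d: "0 < d" "cball x d \<subseteq> {z. 0 < Re z}"
    using open_contains_cball[of "{z. 0 < Re z}"] open_halfspace_Re_gt by blast
  have "uniform_limit (cball x d) (\<lambda>n z. \<Sum>l<n. a l * (gamma_P l (of_real r * z) / z ^ l))
      (borel_sum r a) sequentially"
    unfolding borel_sum_def
    using d norm_borel_term_le by (intro Weierstrass_m_test[OF _ summable_majorant]) blast
  with d show "\<exists>d>0. cball x d \<subseteq> {z. 0 < Re z} \<and>
      uniform_limit (cball x d) (\<lambda>n z. \<Sum>l<n. a l * (gamma_P l (of_real r * z) / z ^ l))
        (borel_sum r a) sequentially"
    by blast
qed

lemma sums_geometric_deriv: "(\<lambda>l. real (Suc l) * (r / \<sigma>) ^ l) sums (1 / (1 - r / \<sigma>)\<^sup>2)"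
  using r by (intro geometric_deriv_sums) simp

text \<open>Watson's lemma: the tail of the Borel sum satisfies, up to a constant factor, the bound for
  its first term.\<close>

lemma norm_borel_tail_le:
  assumes z: "0 < Re z"
  shows "norm (\<Sum>l. a (l + Suc n) * (gamma_P (l + Suc n) (of_real r * z) / z ^ (l + Suc n)))
    \<le> C * fact (Suc n) / (\<sigma> * Re z) ^ Suc n * (1 / (1 - r / \<sigma>)\<^sup>2)"
proof -
  define x where "x = Re z"
  define K where "K = C * fact (Suc n) / (\<sigma> * x) ^ Suc n"
  have x: "x > 0" and z0: "norm z > 0" using z by (auto simp: x_def)
  have K: "K \<ge> 0" using C_nonneg x r by (simp add: K_def)
  have le: "norm (a (l + Suc n) * (gamma_P (l + Suc n) (of_real r * z) / z ^ (l + Suc n)))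
      \<le> K * (real (Suc l) * (r / \<sigma>) ^ l)" for l
  proof -
    have "norm (a (l + Suc n) * (gamma_P (l + Suc n) (of_real r * z) / z ^ (l + Suc n)))
        = norm (a (Suc (l + n))) * (norm (gamma_P (Suc (l + n)) (of_real r * z)) / norm z ^ Suc (l + n))"
      by (simp add: norm_mult norm_divide norm_power)
    also have "\<dots> \<le> (C * fact (Suc (l + n)) / \<sigma> ^ Suc (l + n))
        * ((norm z ^ Suc (l + n) * (r ^ (l + n - n) * fact n / (fact (l + n) * Re z ^ Suc n)))
            / norm z ^ Suc (l + n))"
      using z r C_nonneg
      by (intro mult_mono divide_right_mono norm_gamma_P_le_decay a divide_nonneg_nonneg) auto
    also have "\<dots> = (C * fact n / (\<sigma> * x) ^ Suc n * (r / \<sigma>) ^ l) * real (Suc (l + n))"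
      using z0 x r by (simp add: x_def power_divide power_mult_distrib power_add divide_simps)
    also have "\<dots> \<le> (C * fact n / (\<sigma> * x) ^ Suc n * (r / \<sigma>) ^ l) * (real (Suc n) * real (Suc l))"
      using x r C_nonneg by (intro mult_left_mono) (auto simp: algebra_simps)
    also have "\<dots> = K * (real (Suc l) * (r / \<sigma>) ^ l)"
      by (simp add: K_def mult_ac)
    finally show ?thesis .
  qed
  have K_sums: "(\<lambda>l. K * (real (Suc l) * (r / \<sigma>) ^ l)) sums (K * (1 / (1 - r / \<sigma>)\<^sup>2))"
    by (intro sums_mult sums_geometric_deriv)
  have "norm (\<Sum>l. a (l + Suc n) * (gamma_P (l + Suc n) (of_real r * z) / z ^ (l + Suc n)))
      \<le> (\<Sum>l. K * (real (Suc l) * (r / \<sigma>) ^ l))"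
    by (rule norm_suminf_le) (rule le, rule sums_summable[OF K_sums])
  also have "\<dots> = K * (1 / (1 - r / \<sigma>)\<^sup>2)" by (rule sums_unique[OF K_sums, symmetric])
  finally show ?thesis by (simp only: K_def x_def)
qed

text \<open>
  Cutting off the Laplace integral changes each of the first \<open>N\<close> terms by an exponentially small
  amount only, since \<open>Re z \<ge> c \<bar>z\<bar>\<close> bounds \<open>e\<^sup>-\<^sup>r\<^sup>z\<close>.
\<close>

lemma norm_borel_head_le:
  assumes c: "0 < c" "c * norm z \<le> Re z" and z: "1 \<le> norm z"
  shows "norm (a l / z ^ l * (gamma_P l (of_real r * z) - 1))
    \<le> (C * fact l / \<sigma> ^ l * exp r * fact N / (r * c) ^ N) * (1 / norm z ^ N)"
proof -
  have x: "0 < Re z" using c z by (smt (verit) mult_pos_pos)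
  have "exp (- (r * Re z)) \<le> fact N / (r * Re z) ^ N"
    using x r by (intro exp_minus_le_inverse_power) simp
  also have "\<dots> \<le> fact N / (r * (c * norm z)) ^ N"
    using c z r x by (intro divide_left_mono power_mono mult_left_mono mult_pos_pos zero_less_power) auto
  finally have e: "exp (- (r * Re z)) \<le> fact N / (r * c) ^ N * (1 / norm z ^ N)"
    by (simp add: power_mult_distrib)
  have "norm (\<Sum>k<l. (of_real r * z) ^ k / fact k) \<le> (\<Sum>k<l. norm ((of_real r * z) ^ k / fact k))"
    by (rule norm_sum)
  also have "\<dots> \<le> (\<Sum>k<l. norm z ^ l * (r ^ k / fact k))"
  proof (rule sum_mono)
    fix k assume "k \<in> {..<l}"
    then have "norm z ^ k \<le> norm z ^ l" using z by (intro power_increasing) auto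
    then have "norm z ^ k * (r ^ k / fact k) \<le> norm z ^ l * (r ^ k / fact k)"
      using r by (intro mult_right_mono) auto
    then show "norm ((of_real r * z) ^ k / fact k) \<le> norm z ^ l * (r ^ k / fact k)"
      using r by (simp add: norm_mult norm_divide norm_power power_mult_distrib mult_ac)
  qed
  also have "\<dots> \<le> norm z ^ l * exp r"
    unfolding sum_distrib_left[symmetric] using r by (intro mult_left_mono exp_partial_sum_le) auto
  finally have s: "norm (\<Sum>k<l. (of_real r * z) ^ k / fact k) \<le> norm z ^ l * exp r" .
  have "norm (a l / z ^ l * (gamma_P l (of_real r * z) - 1))
      = norm (a l) / norm z ^ l * (exp (- (r * Re z)) * norm (\<Sum>k<l. (of_real r * z) ^ k / fact k))"
    by (simp add: gamma_P_def norm_mult norm_divide norm_power norm_exp_eq_Re)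
  also have "\<dots> \<le> (C * fact l / \<sigma> ^ l) / norm z ^ l
      * ((fact N / (r * c) ^ N * (1 / norm z ^ N)) * (norm z ^ l * exp r))"
    using C_nonneg r c by (intro mult_mono divide_right_mono a e s) auto
  also have "\<dots> = (C * fact l / \<sigma> ^ l * exp r * fact N / (r * c) ^ N) * (1 / norm z ^ N)"
    using z by (auto simp: mult_ac)
  finally show ?thesis .
qed

lemma asymptotic_series_borel_sum:
  assumes c: "0 < c" and S: "\<And>z. z \<in> S \<Longrightarrow> c * norm z \<le> Re z"
  shows "asymptotic_series S (borel_sum r a) a"
  unfolding asymptotic_series_def
proof
  fix N
  define T where "T = (\<lambda>z l. a l * (gamma_P l (of_real r * z) / z ^ l))"
  have "\<exists>K. \<forall>z. 1 \<le> norm z \<and> z \<in> S \<longrightarrow>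
      norm (borel_sum r a z - (\<Sum>l<N. a l / z ^ l)) \<le> K * (1 / norm z ^ N)"
  proof (cases N)
    case 0
    have "norm (borel_sum r a z) \<le> (\<Sum>l. C * (r / \<sigma>) ^ l)" if "1 \<le> norm z" "z \<in> S" for z
    proof -
      have "0 < Re z" using c S[of z] that by (smt (verit) mult_pos_pos)
      from norm_suminf_le[OF norm_borel_term_le[OF this] summable_majorant]
      show ?thesis by (simp add: borel_sum_def)
    qed
    then show ?thesis using 0 by auto
  next
    case (Suc n)
    define K1 where "K1 = (\<Sum>l<N. C * fact l / \<sigma> ^ l * exp r * fact N / (r * c) ^ N)"
    define K2 where "K2 = C * fact N * (1 / (1 - r / \<sigma>)\<^sup>2) / (\<sigma> * c) ^ N"
    have "norm (borel_sum r a z - (\<Sum>l<N. a l / z ^ l)) \<le> (K1 + K2) * (1 / norm z ^ N)"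
      if z: "1 \<le> norm z" "z \<in> S" for z
    proof -
      have x: "0 < Re z" using c S[of z] z by (smt (verit) mult_pos_pos)
      have "borel_sum r a z - (\<Sum>l<N. a l / z ^ l) = (\<Sum>l. T z (l + N)) + (\<Sum>l<N. T z l - a l / z ^ l)"
        using suminf_split_initial_segment[OF summable_borel_term[OF x], of N]
        by (simp add: borel_sum_def T_def sum_subtractf)
      also have "(\<Sum>l<N. T z l - a l / z ^ l) = (\<Sum>l<N. a l / z ^ l * (gamma_P l (of_real r * z) - 1))"
        by (simp add: T_def algebra_simps)
      also have "norm ((\<Sum>l. T z (l + N)) + \<dots>) \<le> C * fact N / (\<sigma> * Re z) ^ N * (1 / (1 - r / \<sigma>)\<^sup>2)
          + (\<Sum>l<N. (C * fact l / \<sigma> ^ l * exp r * fact N / (r * c) ^ N) * (1 / norm z ^ N))"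
        unfolding T_def Suc using norm_borel_tail_le[OF x, of n] S z c
        by (intro norm_triangle_mono sum_norm_le norm_borel_head_le) auto
      also have "\<dots> \<le> C * fact N / (\<sigma> * (c * norm z)) ^ N * (1 / (1 - r / \<sigma>)\<^sup>2) + K1 * (1 / norm z ^ N)"
        unfolding K1_def sum_distrib_right using C_nonneg r S z c x
        by (intro add_mono order_refl mult_right_mono divide_left_mono power_mono mult_left_mono
            mult_pos_pos zero_less_power) auto
      also have "\<dots> = (K1 + K2) * (1 / norm z ^ N)"
        by (simp add: K2_def power_mult_distrib algebra_simps)
      finally show ?thesis .
    qed
    then show ?thesis by blast
  qed
  then obtain K where K: "\<And>z. 1 \<le> norm z \<Longrightarrow> z \<in> S \<Longrightarrow>
      norm (borel_sum r a z - (\<Sum>l<N. a l / z ^ l)) \<le> K * (1 / norm z ^ N)"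
    by blast
  show "(\<lambda>z. borel_sum r a z - (\<Sum>l<N. a l / z ^ l))
      \<in> O[inf at_infinity (principal S)](\<lambda>z. complex_of_real (1 / norm z ^ N))"
  proof (rule bigoI)
    show "\<forall>\<^sub>F z in inf at_infinity (principal S). norm (borel_sum r a z - (\<Sum>l<N. a l / z ^ l))
        \<le> K * norm (complex_of_real (1 / norm z ^ N))"
      unfolding eventually_inf_principal eventually_at_infinity
    proof (intro exI allI impI)
      fix z :: complex assume "1 \<le> norm z" "z \<in> S"
      from K[OF this] show "norm (borel_sum r a z - (\<Sum>l<N. a l / z ^ l))
          \<le> K * norm (complex_of_real (1 / norm z ^ N))"
        by (simp add: norm_divide norm_power)
    qed
  qed
qed

text \<open>
  Summation by parts turns the partial sums of the Borel sum into averages of the partial sums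
  \<open>T k\<close> of the divergent series, with the Poisson weights \<open>e\<^sup>-\<^sup>r\<^sup>x (r x)\<^sup>k / k!\<close>. The factor \<open>1 / k!\<close> of the
  weights absorbs the factorial growth of the error of \<open>T (k + 1)\<close>, and leaves a convergent series
  times \<open>e\<^sup>-\<^sup>r\<^sup>x\<close>.
\<close>

lemma norm_minus_borel_sum_le:
  fixes x :: real and u :: complex
  assumes x: "0 < x"
    and u: "\<And>n. norm (u - (\<Sum>l<n. a l / of_real x ^ l)) \<le> C * fact n / (\<sigma> * x) ^ n"
  shows "norm (u - borel_sum r a (of_real x)) \<le> C / (\<sigma> * x) * (1 / (1 - r / \<sigma>)\<^sup>2) * exp (- (r * x))"
proof -
  define P where "P = (\<lambda>l. gamma_P l (complex_of_real (r * x)))"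
  define T where "T = (\<lambda>n. \<Sum>l<n. a l / complex_of_real x ^ l)"
  define w where "w = (\<lambda>k. exp (- complex_of_real (r * x)) * (of_real (r * x) ^ k / fact k))"
  define q where "q = r / \<sigma>"
  have q: "0 < q" "q < 1" using r by (auto simp: q_def)
  define B where "B = C / (\<sigma> * x) * (1 / (1 - q)\<^sup>2) * exp (- (r * x))"
  have P_Suc: "P (Suc k) = P k - w k" for k
    by (simp add: P_def w_def gamma_P_Suc)
  have parts: "u - (\<Sum>l<n. a l / of_real x ^ l * P l) = (u - T n) * P n + (\<Sum>k<n. (u - T (Suc k)) * w k)"
    for n
  proof (induction n)
    case (Suc n)
    have aP: "a n / of_real x ^ n * P n = (T (Suc n) - T n) * P n" by (simp add: T_def)
    have "u - (\<Sum>l<Suc n. a l / of_real x ^ l * P l)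
        = (u - T n) * P n + (\<Sum>k<n. (u - T (Suc k)) * w k) - (T (Suc n) - T n) * P n"
      by (simp only: sum.lessThan_Suc aP diff_diff_eq[symmetric] Suc.IH)
    also have "\<dots> = (u - T (Suc n)) * P (Suc n) + (\<Sum>k<Suc n. (u - T (Suc k)) * w k)"
      by (simp add: P_Suc algebra_simps)
    finally show ?case .
  qed (simp add: P_def T_def)
  have err: "norm (u - T n) \<le> C * fact n / (\<sigma> * x) ^ n" for n
    using u by (simp add: T_def)
  have le: "norm (u - (\<Sum>l<n. a l / of_real x ^ l * P l)) \<le> C * q ^ n + B" for n
  proof -
    have "norm ((u - T n) * P n) \<le> C * fact n / (\<sigma> * x) ^ n * (x ^ n * r ^ n / fact n)"
      unfolding norm_mult using err[of n] norm_gamma_P_le_power[of "of_real x" r n] r x C_nonneg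
      by (intro mult_mono) (auto simp: P_def)
    also have "\<dots> = C * q ^ n"
      using x by (simp add: q_def power_divide power_mult_distrib)
    finally have 1: "norm ((u - T n) * P n) \<le> C * q ^ n" .
    have "norm (\<Sum>k<n. (u - T (Suc k)) * w k)
        \<le> (\<Sum>k<n. C / (\<sigma> * x) * exp (- (r * x)) * (real (Suc k) * q ^ k))"
    proof (rule sum_norm_le)
      fix k
      have "norm ((u - T (Suc k)) * w k)
          = norm (u - T (Suc k)) * (exp (- (r * x)) * ((r * x) ^ k / fact k))"
        using r x by (simp add: w_def norm_mult norm_divide norm_power power_mult_distrib norm_exp_eq_Re)
      also have "\<dots> \<le> C * fact (Suc k) / (\<sigma> * x) ^ Suc k * (exp (- (r * x)) * ((r * x) ^ k / fact k))"
        using r x by (intro mult_right_mono err) auto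
      also have "\<dots> = C / (\<sigma> * x) * exp (- (r * x)) * (real (Suc k) * q ^ k)"
        using x r by (simp add: q_def power_divide power_mult_distrib divide_simps)
      finally show "norm ((u - T (Suc k)) * w k)
          \<le> C / (\<sigma> * x) * exp (- (r * x)) * (real (Suc k) * q ^ k)" .
    qed
    also have "\<dots> = C / (\<sigma> * x) * exp (- (r * x)) * (\<Sum>k<n. real (Suc k) * q ^ k)"
      by (simp add: sum_distrib_left)
    also have "\<dots> \<le> C / (\<sigma> * x) * exp (- (r * x)) * (1 / (1 - q)\<^sup>2)"
      using sum_le_suminf[OF sums_summable[OF sums_geometric_deriv], of "{..<n}"]
        sums_unique[OF sums_geometric_deriv] C_nonneg r x q
      by (intro mult_left_mono) (auto simp: q_def)
    finally have 2: "norm (\<Sum>k<n. (u - T (Suc k)) * w k) \<le> B" by (simp add: B_def mult_ac)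
    show ?thesis unfolding parts by (rule norm_triangle_mono[OF 1 2])
  qed
  have "(\<lambda>n. \<Sum>l<n. a l / of_real x ^ l * P l) \<longlonglongrightarrow> borel_sum r a (of_real x)"
    using summable_LIMSEQ[OF summable_borel_term[of "of_real x"]] x
    by (simp add: borel_sum_def P_def)
  then have lim: "(\<lambda>n. norm (u - (\<Sum>l<n. a l / of_real x ^ l * P l)))
      \<longlonglongrightarrow> norm (u - borel_sum r a (of_real x))"
    by (intro tendsto_intros)
  have "(\<lambda>n. C * q ^ n + B) \<longlonglongrightarrow> C * 0 + B"
    using q by (intro tendsto_intros LIMSEQ_power_zero) auto
  then have "norm (u - borel_sum r a (of_real x)) \<le> C * 0 + B"
    using lim le by (intro LIMSEQ_le[OF lim]) auto
  then show ?thesis by (simp add: B_def q_def)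
qed

end

section \<open>Iterated derivatives along an interval\<close>

lemma deriv_on_eqI:
  "(f has_vector_derivative f') (at x within S) \<Longrightarrow> at x within S \<noteq> bot \<Longrightarrow> deriv_on S f x = f'"
  by (simp add: deriv_on_def vector_derivative_within)

lemma smooth_on_has_vector_derivative:
  assumes "smooth_on S f" "x \<in> S"
  shows "((deriv_on S ^^ n) f has_vector_derivative (deriv_on S ^^ Suc n) f x) (at x within S)"
  using assms vector_derivative_works
  by (auto simp: smooth_on_def differentiable_on_def deriv_on_def)

lemma D_on_iterate:
  assumes f: "smooth_on S f" and S: "\<And>x. x \<in> S \<Longrightarrow> at x within S \<noteq> bot" and "x \<in> S"
  shows "(D_on S ^^ n) f x = (- \<i>) ^ n * (deriv_on S ^^ n) f x"
  using \<open>x \<in> S\<close>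
proof (induction n arbitrary: x)
  case (Suc n)
  have D: "((\<lambda>x. (- \<i>) ^ n * (deriv_on S ^^ n) f x) has_vector_derivative
      (- \<i>) ^ n * (deriv_on S ^^ Suc n) f x) (at x within S)"
    by (intro has_vector_derivative_mult_right smooth_on_has_vector_derivative f Suc.prems)
  have "((D_on S ^^ n) f has_vector_derivative
      (- \<i>) ^ n * (deriv_on S ^^ Suc n) f x) (at x within S)"
    by (rule has_vector_derivative_transform[OF Suc.prems Suc.IH D])
  from deriv_on_eqI[OF this S[OF Suc.prems]] show ?case
    by (simp add: D_on_def[of S "(D_on S ^^ n) f"])
qed simp

text \<open>
  The functions \<open>(deriv_on S ^^ n) h\<close> need not be meaningful off \<open>S\<close>. Every identity
  between iterated derivatives is therefore restricted to \<open>S\<close>, which suffices for differentiation within \<open>S\<close>.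
\<close>

lemma smooth_on_diff_holomorphic:
  assumes f: "smooth_on S f" and g: "g holomorphic_on U" "open U" "complex_of_real ` S \<subseteq> U"
    and S: "\<And>x. x \<in> S \<Longrightarrow> at x within S \<noteq> bot"
  shows "smooth_on S (\<lambda>x. f x - g (of_real x))"
proof -
  let ?h = "\<lambda>x. f x - g (complex_of_real x)"
  define E where "E = (\<lambda>n x. (deriv_on S ^^ n) f x - (deriv ^^ n) g (complex_of_real x))"
  have E: "(E n has_vector_derivative E (Suc n) x) (at x within S)" if x: "x \<in> S" for n x
  proof -
    have "((deriv ^^ n) g has_field_derivative (deriv ^^ Suc n) g (of_real x)) (at (of_real x))"
      using holomorphic_derivI[OF holomorphic_higher_deriv[OF g(1,2)] g(2)] g(3) x by auto
    from has_vector_derivative_real_field[OF this] show ?thesis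
      unfolding E_def
      by (intro has_vector_derivative_diff smooth_on_has_vector_derivative f x)
  qed
  have eq: "(deriv_on S ^^ n) ?h x = E n x" if "x \<in> S" for n x
    using that
  proof (induction n arbitrary: x)
    case (Suc n)
    have "((deriv_on S ^^ n) ?h has_vector_derivative E (Suc n) x) (at x within S)"
      by (rule has_vector_derivative_transform[OF Suc.prems Suc.IH E[OF Suc.prems]])
    from deriv_on_eqI[OF this S[OF Suc.prems]] show ?case by simp
  qed (simp add: E_def)
  have "((deriv_on S ^^ n) ?h has_vector_derivative E (Suc n) x) (at x within S)" if "x \<in> S" for n x
    by (rule has_vector_derivative_transform[OF that eq E[OF that]])
  then show ?thesis
    unfolding smooth_on_def differentiable_on_def by (blast intro: differentiableI_vector)
qed

lemma at_within_atLeast_neq_bot: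
  fixes x :: real
  assumes "a \<le> x"
  shows "at x within {a..} \<noteq> bot"
proof -
  have "at_right x \<le> at x within {a..}" using assms by (intro at_le) auto
  then show ?thesis by (metis trivial_limit_at_right_real bot.extremum_uniqueI)
qed

lemma gevrey2_derivative_bound:
  assumes "W \<in> gevrey2 \<sigma>"
  obtains C where "\<And>n x. x \<in> {0..1} \<Longrightarrow> norm ((deriv_on {0..1} ^^ n) W x) \<le> C * (1 / \<sigma> ^ n) * (fact n)\<^sup>2"
proof -
  have nontriv: "at x within {0..1} \<noteq> bot" if "x \<in> {0..1}" for x :: real
    using that by (simp add: trivial_limit_within islimpt_Icc)
  from assms obtain C where W: "smooth_on {0..1} W"
    and C: "\<And>n x. x \<in> {0..1} \<Longrightarrow> norm ((D_on {0..1} ^^ n) W x) \<le> C * (1 / \<sigma> ^ n) * (fact n)\<^sup>2"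
    unfolding gevrey2_def by blast
  show ?thesis
  proof (rule that[of C])
    fix n and x :: real assume x: "x \<in> {0..1}"
    show "norm ((deriv_on {0..1} ^^ n) W x) \<le> C * (1 / \<sigma> ^ n) * (fact n)\<^sup>2"
      using C[OF x, of n] D_on_iterate[OF W nontriv x, of n] by (simp add: norm_mult norm_power)
  qed
qed

lemma sector_subset_cone:
  assumes "0 < \<epsilon>"
  obtains c where "0 < c" "\<And>z. z \<in> sector \<epsilon> \<Longrightarrow> c * norm z \<le> Re z"
proof (cases "\<epsilon> < pi / 2")
  case True
  have "sin \<epsilon> * norm z \<le> Re z" if "z \<in> sector \<epsilon>" for z
  proof -
    have "sin \<epsilon> = cos (pi / 2 - \<epsilon>)" by (simp add: cos_diff)
    also have "\<dots> \<le> cos \<bar>Arg z\<bar>"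
      using that assms True by (intro cos_monotone_0_pi_le) (auto simp: sector_def)
    also have "\<dots> = Re z / norm z" using that by (simp add: sector_def cos_Arg)
    finally show ?thesis using that by (simp add: sector_def field_simps)
  qed
  moreover have "0 < sin \<epsilon>" using assms True by (intro sin_gt_zero) auto
  ultimately show ?thesis by (rule that[rotated])
next
  case False
  then have "sector \<epsilon> = {}" by (auto simp: sector_def)
  then show ?thesis using that[of 1] by simp
qed

section \<open>The decomposition\<close>

theorem proposition2p1:
  fixes \<sigma> \<rho> \<epsilon> :: real and V W :: "real \<Rightarrow> complex"
  assumes "\<sigma> > 0"
    and "smooth_on {1..} V"
    and "W \<in> gevrey2 \<sigma>"
    and "\<And>x. x \<in> {1..} \<Longrightarrow> V x = W (1 / x)"
    and "\<rho> < \<sigma>"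
    and "\<epsilon> > 0"
  shows "\<exists>(V1 :: real \<Rightarrow> complex) (V2 :: complex \<Rightarrow> complex).
           (\<forall>x\<in>{1..}. V x = V1 x + V2 (complex_of_real x)) \<and>
           smooth_on {1..} V1 \<and>
           (\<exists>C. \<forall>x\<in>{1..}. norm (V1 x) \<le> C * exp (- \<rho> * x)) \<and>
           V2 holomorphic_on sector \<epsilon> \<and>
           asymptotic_series (sector \<epsilon>) V2 (\<lambda>l. (deriv_on {0..1} ^^ l) W 0 / fact l)"
proof -
  define D where "D = (\<lambda>n. (deriv_on {0..1} ^^ n) W)"
  define a where "a = (\<lambda>l. D l 0 / fact l)"
  \<comment> \<open>As \<open>\<rho> \<le> 0\<close> is possible, \<open>\<rho>\<close> itself need not be a positive cut-off of the Laplace integral.\<close>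
  define r where "r = (max \<rho> 0 + \<sigma>) / 2"
  have r: "0 < r" "r < \<sigma>" "\<rho> \<le> r" using assms(1,5) by (auto simp: r_def)
  obtain C where C: "\<And>n x. x \<in> {0..1} \<Longrightarrow> norm (D n x) \<le> C * (1 / \<sigma> ^ n) * (fact n)\<^sup>2"
    using gevrey2_derivative_bound[OF assms(3)] unfolding D_def by blast
  have a: "norm (a l) \<le> C * fact l / \<sigma> ^ l" for l
    using C[of 0 l] by (simp add: a_def norm_divide power2_eq_square field_simps)
  have C0: "0 \<le> C" by (rule C_nonneg[OF a r(1,2)])
  have D: "(D n has_vector_derivative D (Suc n) s) (at s within {0..1})" if "s \<in> {0..1}" for n s
    using smooth_on_has_vector_derivative[of "{0..1}" W s n] assms(3) that
    by (simp add: gevrey2_def D_def)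
  have taylor: "norm (V x - (\<Sum>l<n. a l / of_real x ^ l)) \<le> C * fact n / (\<sigma> * x) ^ n" if x: "1 \<le> x" for x n
  proof -
    have "norm (D 0 (1 / x) - (\<Sum>i<n. ((1 / x) ^ i / fact i) *\<^sub>R D i 0))
        \<le> C * (1 / \<sigma> ^ n) * (fact n)\<^sup>2 * (1 / x) ^ n / fact n"
      using x by (intro taylor_remainder_bound[of 1 D n _ "1 / x", OF D C]) auto
    moreover have "((1 / x) ^ i / fact i) *\<^sub>R D i 0 = a i / of_real x ^ i" for i
      by (simp add: a_def scaleR_conv_of_real power_divide)
    ultimately show ?thesis
      using assms(4)[of x] x
      by (simp add: D_def power_divide power_mult_distrib power2_eq_square mult_ac)
  qed
  define V2 where "V2 = borel_sum r a"
  define V1 where "V1 = (\<lambda>x. V x - V2 (complex_of_real x))"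
  have holo: "V2 holomorphic_on {z. 0 < Re z}"
    unfolding V2_def by (rule holomorphic_borel_sum[OF a r(1,2)])
  obtain c where c: "0 < c" "\<And>z. z \<in> sector \<epsilon> \<Longrightarrow> c * norm z \<le> Re z"
    using sector_subset_cone[OF assms(6)] by blast
  have "sector \<epsilon> \<subseteq> {z. 0 < Re z}"
  proof
    fix z assume z: "z \<in> sector \<epsilon>"
    then have "0 < c * norm z" using c(1) by (simp add: sector_def)
    then show "z \<in> {z. 0 < Re z}" using c(2)[OF z] by simp
  qed
  then have "V2 holomorphic_on sector \<epsilon>" by (rule holomorphic_on_subset[OF holo])
  moreover have "asymptotic_series (sector \<epsilon>) V2 a"
    unfolding V2_def by (rule asymptotic_series_borel_sum[OF a r(1,2) c])
  moreover have "smooth_on {1..} V1"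
    unfolding V1_def
    by (rule smooth_on_diff_holomorphic[OF assms(2) holo open_halfspace_Re_gt])
       (auto simp: at_within_atLeast_neq_bot)
  moreover have "\<exists>C. \<forall>x\<in>{1..}. norm (V1 x) \<le> C * exp (- \<rho> * x)"
  proof (intro exI ballI)
    fix x :: real assume "x \<in> {1..}"
    then have x: "1 \<le> x" by simp
    have "norm (V1 x) \<le> C / (\<sigma> * x) * (1 / (1 - r / \<sigma>)\<^sup>2) * exp (- (r * x))"
      unfolding V1_def V2_def
      using x by (intro norm_minus_borel_sum_le[OF a r(1,2)] taylor) auto
    also have "\<dots> \<le> C / \<sigma> * (1 / (1 - r / \<sigma>)\<^sup>2) * exp (- \<rho> * x)"
      using x r C0 by (intro mult_mono divide_left_mono) auto
    finally show "norm (V1 x) \<le> C / \<sigma> * (1 / (1 - r / \<sigma>)\<^sup>2) * exp (- \<rho> * x)" .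
  qed
  moreover have "\<forall>x\<in>{1..}. V x = V1 x + V2 (complex_of_real x)" by (simp add: V1_def)
  ultimately show ?thesis
    unfolding a_def D_def by (intro exI[of _ V1] exI[of _ V2] conjI)
qed

end
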